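(* For any positive infinitesimal $\rho$ in ${}^*\mathbb{R}$ there exists a $\rho$-delta function, i.e. a function $D\in{}^*\mathcal{D}(\mathbb{R}^d)$ with values in ${}^*\mathbb{R}$ which is symmetric and satisfies: (i) $D(x)=0$ for $x\in{}^*\mathbb{R}^d$, $\|x\|\ge\rho$; (ii) $\int_{{}^*\mathbb{R}^d}D(x)\,dx=1$; (iii) $\int_{{}^*\mathbb{R}^d}D(x)x^\alpha\,dx=0$ for all $\alpha\in\mathbb{N}_0^d$, $\alpha\ne0$; (iv) $\int_{{}^*\mathbb{R}^d}|D(x)|\,dx\approx1$; (v) $|\ln\rho|^{-1}\Big(\rho^{d+|\alpha|}\sup_{x\in{}^*\mathbb{R}^d}|\partial^\alpha D(x)|\Big)\approx0$ for all $\alpha\in\mathbb{N}_0^d$.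
   Context: Work in a nonstandard model of the complex numbers $\mathbb{C}$ with degree of saturation larger than $\mathrm{card}(\mathbb{N})$ (in particular, every countable family of internal sets with the finite intersection property has nonempty intersection). $d$ is a (standard) natural number; $\mathbb{N}=\{1,2,\dots\}$, $\mathbb{N}_0=\{0\}\cup\mathbb{N}$, so multiindices $\alpha\in\mathbb{N}_0^d$ are standard. $\mathcal{D}(\mathbb{R}^d)=C_0^\infty(\mathbb{R}^d)$ (complex-valued) and ${}^*\mathcal{D}(\mathbb{R}^d)$ is its nonstandard extension. $\|\cdot\|$ is the Euclidean norm (and its extension), integrals are $*$-Lebesgue integrals, $\approx$ is the infinitesimal relation in ${}^*\mathbb{C}$. Symmetric means $D(-x)=D(x)$. *)

theory Defs
  imports "HOL-Analysis.Analysis"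
begin

section \<open>Nonstandard models\<close>

text \<open>First-order formulas with named variables. The relation symbols of type \<^typ>\<open>'r\<close> take
  argument lists of any length.\<close>

datatype 'r fm =
    FRel 'r "nat list"
  | FEq nat nat
  | FNot "'r fm"
  | FAnd "'r fm" "'r fm"
  | FEx nat "'r fm"

primrec sat :: "('r \<Rightarrow> 'a list set) \<Rightarrow> 'r fm \<Rightarrow> (nat \<Rightarrow> 'a) \<Rightarrow> bool" where
  "sat I (FRel r xs) e \<longleftrightarrow> map e xs \<in> I r"
| "sat I (FEq x y) e \<longleftrightarrow> e x = e y"
| "sat I (FNot p) e \<longleftrightarrow> \<not> sat I p e"
| "sat I (FAnd p q) e \<longleftrightarrow> sat I p e \<and> sat I q e"
| "sat I (FEx x p) e \<longleftrightarrow> (\<exists>a. sat I p (e(x := a)))"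

text \<open>A nonstandard extension of a universe \<^typ>\<open>'u\<close> consists of a map \<open>star\<close> sending an object
  \<open>a\<close> of the universe to \<open>*a\<close> in \<^typ>\<open>'h\<close> (the type \<^typ>\<open>'h\<close> is the extension of the whole
  universe; it contains all internal objects of the sorts in \<^typ>\<open>'u\<close>), and a map \<open>ext\<close> sending
  a relation \<open>R\<close> on \<^typ>\<open>'u\<close>, of any finite arity, to \<open>*R\<close> on \<^typ>\<open>'h\<close>.
  The language of the transfer principle has a symbol for every relation on \<^typ>\<open>'u\<close>; an
  assignment of the variables supplies the standard parameters.\<close>

definition transfer_principle ::
    "('u \<Rightarrow> 'h) \<Rightarrow> ('u list set \<Rightarrow> 'h list set) \<Rightarrow> bool" where
  "transfer_principle star ext \<longleftrightarrow> (\<forall>p e. sat (\<lambda>R. R) p e \<longleftrightarrow> sat ext p (star \<circ> e))"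

definition internal :: "('u list set \<Rightarrow> 'h list set) \<Rightarrow> 'h set \<Rightarrow> bool" where
  "internal ext A \<longleftrightarrow> (\<exists>R ps. A = {h. h # ps \<in> ext R})"

definition countably_saturated :: "('u list set \<Rightarrow> 'h list set) \<Rightarrow> bool" where
  "countably_saturated ext \<longleftrightarrow>
    (\<forall>\<A>. countable \<A> \<longrightarrow> (\<forall>A\<in>\<A>. internal ext A) \<longrightarrow>
      (\<forall>\<F>. finite \<F> \<longrightarrow> \<F> \<subseteq> \<A> \<longrightarrow> \<Inter>\<F> \<noteq> {}) \<longrightarrow> \<Inter>\<A> \<noteq> {})"

definition nonstandard_model ::
    "('u \<Rightarrow> 'h) \<Rightarrow> ('u list set \<Rightarrow> 'h list set) \<Rightarrow> bool" where
  "nonstandard_model star ext \<longleftrightarrow> transfer_principle star ext \<and> countably_saturated ext"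

text \<open>Extensions \<open>*A\<close>, \<open>*R\<close> and \<open>*F\<close> of sets, binary relations and functions. By transfer the extension of the graph
  of a function is again the graph of a function, so the descriptions below are proper.\<close>

definition hset :: "('u list set \<Rightarrow> 'h list set) \<Rightarrow> 'u set \<Rightarrow> 'h set" where
  "hset ext A = {h. [h] \<in> ext {[a] |a. a \<in> A}}"

definition hrel :: "('u list set \<Rightarrow> 'h list set) \<Rightarrow> ('u \<Rightarrow> 'u \<Rightarrow> bool) \<Rightarrow> 'h \<Rightarrow> 'h \<Rightarrow> bool" where
  "hrel ext R h k \<longleftrightarrow> [h, k] \<in> ext {[a, b] |a b. R a b}"

definition hfun :: "('u list set \<Rightarrow> 'h list set) \<Rightarrow> ('u \<Rightarrow> 'u) \<Rightarrow> 'h \<Rightarrow> 'h" where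
  "hfun ext F h = (THE y. [h, y] \<in> ext {[a, F a] |a. True})"

definition hfun2 :: "('u list set \<Rightarrow> 'h list set) \<Rightarrow> ('u \<Rightarrow> 'u \<Rightarrow> 'u) \<Rightarrow> 'h \<Rightarrow> 'h \<Rightarrow> 'h" where
  "hfun2 ext F h k = (THE y. [h, k, y] \<in> ext {[a, b, F a b] |a b. True})"


section \<open>The standard universe\<close>

text \<open>Numbers, points of \<open>R\<^sup>d\<close> with \<open>d = CARD('n)\<close>, and all functions from \<open>R\<^sup>d\<close> to the complex
  numbers. The real numbers are the complex numbers in \<^term>\<open>\<real>\<close>.
  A nonstandard model of the full superstructure over the complex numbers restricts to a
  nonstandard model of this universe: each universe is a set of the superstructure, so transfer is
  inherited, and every set that is internal in the sense above is internal in the superstructure,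
  so saturation is inherited as well.
  The selectors are unspecified on objects of the wrong sort; they are only applied, after
  extension, to arguments of the right sort.\<close>

datatype ('n::finite) obj =
    Num (num: complex)
  | Pt (pt: "real ^ 'n")
  | Fn (fn: "real ^ 'n \<Rightarrow> complex")

abbreviation rl :: "'n::finite obj \<Rightarrow> real" where
  "rl a \<equiv> Re (num a)"

abbreviation Rl :: "real \<Rightarrow> 'n::finite obj" where
  "Rl r \<equiv> Num (complex_of_real r)"


section \<open>Test functions and partial derivatives\<close>

definition partial :: "'n::finite \<Rightarrow> (real ^ 'n \<Rightarrow> complex) \<Rightarrow> real ^ 'n \<Rightarrow> complex" where
  "partial i f x = vector_derivative (\<lambda>t. f (x + t *\<^sub>R axis i 1)) (at 0)"

definition has_partials :: "(real ^ 'n::finite \<Rightarrow> complex) \<Rightarrow> bool" where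
  "has_partials f \<longleftrightarrow> (\<forall>i x. (\<lambda>t. f (x + t *\<^sub>R axis i 1)) differentiable (at 0))"

primrec cont_diff :: "nat \<Rightarrow> (real ^ 'n::finite \<Rightarrow> complex) \<Rightarrow> bool" where
  "cont_diff 0 f \<longleftrightarrow> continuous_on UNIV f"
| "cont_diff (Suc k) f \<longleftrightarrow>
    continuous_on UNIV f \<and> has_partials f \<and> (\<forall>i. cont_diff k (partial i f))"

definition test_functions :: "(real ^ 'n::finite \<Rightarrow> complex) set" where
  "test_functions = {f. (\<forall>k. cont_diff k f) \<and> compact (closure {x. f x \<noteq> 0})}"

text \<open>A multiindex is a function \<open>\<alpha> :: 'n \<Rightarrow> nat\<close>. The order in which the partial derivatives are
  taken does not matter for smooth functions; some enumeration of the coordinates is fixed.\<close>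

definition coords :: "'n::finite list" where
  "coords = (SOME is. distinct is \<and> set is = UNIV)"

definition mpartial :: "('n::finite \<Rightarrow> nat) \<Rightarrow> (real ^ 'n \<Rightarrow> complex) \<Rightarrow> real ^ 'n \<Rightarrow> complex" where
  "mpartial \<alpha> f = foldr (\<lambda>i. partial i ^^ \<alpha> i) coords f"

definition mono_pow :: "real ^ 'n::finite \<Rightarrow> ('n \<Rightarrow> nat) \<Rightarrow> real" where
  "mono_pow x \<alpha> = (\<Prod>i\<in>UNIV. (x $ i) ^ \<alpha> i)"

definition mdeg :: "('n::finite \<Rightarrow> nat) \<Rightarrow> nat" where
  "mdeg \<alpha> = (\<Sum>i\<in>UNIV. \<alpha> i)"


section \<open>Delta functions\<close>

definition hreals :: "('n::finite obj list set \<Rightarrow> 'h list set) \<Rightarrow> 'h set" where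
  "hreals ext = hset ext {Num z |z. z \<in> \<real>}"

definition hpoints :: "('n::finite obj list set \<Rightarrow> 'h list set) \<Rightarrow> 'h set" where
  "hpoints ext = hset ext (range Pt)"

definition htest_functions :: "('n::finite obj list set \<Rightarrow> 'h list set) \<Rightarrow> 'h set" where
  "htest_functions ext = hset ext (Fn ` test_functions)"

definition hless :: "('n::finite obj list set \<Rightarrow> 'h list set) \<Rightarrow> 'h \<Rightarrow> 'h \<Rightarrow> bool" where
  "hless ext = hrel ext (\<lambda>a b. \<exists>r s. a = Rl r \<and> b = Rl s \<and> r < s)"

definition infinitely_close :: "('n::finite obj list set \<Rightarrow> 'h list set) \<Rightarrow> 'h \<Rightarrow> 'h \<Rightarrow> bool" where
  "infinitely_close ext h k \<longleftrightarrow>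
    (\<forall>\<epsilon>::real. \<epsilon> > 0 \<longrightarrow> hrel ext (\<lambda>a b. \<exists>z w. a = Num z \<and> b = Num w \<and> cmod (z - w) < \<epsilon>) h k)"

definition happ :: "('n::finite obj list set \<Rightarrow> 'h list set) \<Rightarrow> 'h \<Rightarrow> 'h \<Rightarrow> 'h" where
  "happ ext = hfun2 ext (\<lambda>f x. Num (fn f (pt x)))"

definition hminus :: "('n::finite obj list set \<Rightarrow> 'h list set) \<Rightarrow> 'h \<Rightarrow> 'h" where
  "hminus ext = hfun ext (\<lambda>x. Pt (- pt x))"

text \<open>The internal integrals, and the internal supremum together with the expression it occurs in,
  are the values at \<open>D\<close> (respectively at \<open>\<rho>\<close> and \<open>D\<close>) of the extensions of the corresponding
  standard functionals; the multiindices are standard.\<close>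

definition delta_function ::
    "('n::finite obj \<Rightarrow> 'h) \<Rightarrow> ('n obj list set \<Rightarrow> 'h list set) \<Rightarrow> 'h \<Rightarrow> 'h \<Rightarrow> bool" where
  "delta_function star ext \<rho> D \<longleftrightarrow>
    D \<in> htest_functions ext \<and>
    (\<forall>x\<in>hpoints ext. happ ext D x \<in> hreals ext) \<and>
    (\<forall>x\<in>hpoints ext. happ ext D (hminus ext x) = happ ext D x) \<and>
    (\<forall>x\<in>hpoints ext. hrel ext (\<lambda>x r. norm (pt x) \<ge> rl r) x \<rho> \<longrightarrow> happ ext D x = star (Num 0)) \<and>
    hfun ext (\<lambda>f. Num (LINT x|lebesgue. fn f x)) D = star (Num 1) \<and>
    (\<forall>\<alpha>::'n \<Rightarrow> nat. \<alpha> \<noteq> (\<lambda>_. 0) \<longrightarrow>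
      hfun ext (\<lambda>f. Num (LINT x|lebesgue. fn f x * complex_of_real (mono_pow x \<alpha>))) D
        = star (Num 0)) \<and>
    infinitely_close ext
      (hfun ext (\<lambda>f. Rl (LINT x|lebesgue. cmod (fn f x))) D) (star (Num 1)) \<and>
    (\<forall>\<alpha>::'n \<Rightarrow> nat. infinitely_close ext
      (hfun2 ext (\<lambda>r f. Rl (inverse \<bar>ln (rl r)\<bar> *
        (rl r ^ (CARD('n) + mdeg \<alpha>) * (SUP x. cmod (mpartial \<alpha> (fn f) x))))) \<rho> D)
      (star (Num 0)))"

end

theory Submission
  imports Defs "HOL-Computational_Algebra.Polynomial"
begin

text \<open>
  The analytic content is a statement about standard functions: for every \<open>n\<close> and \<open>\<epsilon> > 0\<close>
  there is a smooth real symmetric \<open>\<phi>\<close> supported in the unit ball of \<open>R\<^sup>d\<close> with integral \<open>1\<close>, with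
  vanishing moments of the orders \<open>1, \<dots>, n\<close>, and with \<open>L\<^sup>1\<close> norm below \<open>1 + \<epsilon>\<close>
  (\<open>ex_vanishing_moments\<close>). The moments are killed one order at a time. Write
  \<open>\<phi>\<^sub>q(x) = q\<^bsup>-d\<^esup> \<phi>(x/q)\<close>. Rescaling keeps the integral and the \<open>L\<^sup>1\<close> norm and multiplies
  the moments of order \<open>k\<close> by \<open>q\<^sup>k\<close>, so with \<open>t = q\<^bsup>n+1\<^esup>\<close> the affine combination
  \<open>(\<phi>\<^sub>q - t \<phi>) / (1 - t)\<close> has integral \<open>1\<close>, its moments vanish
  wherever those of \<open>\<phi>\<close> do, and those of order \<open>n + 1\<close> cancel. Its \<open>L\<^sup>1\<close> norm grows at most by the factor
  \<open>(1 + t) / (1 - t)\<close>, which is as close to \<open>1\<close> as desired when \<open>q\<close> is small. The starting point is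
  a nonnegative bump function, whose \<open>L\<^sup>1\<close> norm equals its integral.

  Rescaling this \<open>\<phi>\<close> to radius \<open>r\<close> makes \<open>r\<^bsup>d+|\<alpha>|\<^esup> sup |\<partial>\<^sup>\<alpha> \<phi>\<^sub>r|\<close> independent of \<open>r\<close>, while
  \<open>|ln r|\<close> tends to infinity as \<open>r\<close> tends to \<open>0\<close>. Hence for every \<open>n\<close> and every sufficiently
  small standard \<open>r\<close> there is a function that satisfies all conditions on a delta function of
  radius \<open>r\<close> for multiindices up to order \<open>n\<close> and with \<open>1/(n+1)\<close> in place of an infinitesimal
  (\<open>ex_approximate_delta\<close>). By transfer the internal set of such functions at the infinitesimal
  radius \<open>\<rho>\<close> is nonempty. These sets decrease with \<open>n\<close>, so saturation yields a common element, and
  that is a delta function because a quantity below \<open>1/(n+1)\<close> for all standard \<open>n\<close> is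
  infinitesimal (\<open>delta_functionI\<close>).
\<close>

section \<open>Smooth functions\<close>

definition smooth :: "(real ^ 'n::finite \<Rightarrow> complex) \<Rightarrow> bool" where
  "smooth f \<longleftrightarrow> (\<forall>k. cont_diff k f)"

text \<open>Functions whose partial derivatives have the same explicit shape again, such as rescaled smooth
  functions or the one-dimensional functions below, are shown to be smooth by exhibiting a class that
  is closed under partial derivatives.\<close>

lemma smooth_coinduct:
  assumes "P f"
    and "\<And>f. P f \<Longrightarrow> continuous_on UNIV f \<and> has_partials f \<and> (\<forall>i. P (partial i f))"
  shows "smooth f"
proof -
  have "cont_diff k f" if "P f" for k f
    using that by (induction k arbitrary: f) (use assms(2) in auto)
  then show ?thesis
    using assms(1) by (auto simp: smooth_def)
qed

lemma smooth_continuous: "smooth f \<Longrightarrow> continuous_on UNIV f"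
  unfolding smooth_def by (metis cont_diff.simps(1))

lemma smooth_has_partials: "smooth f \<Longrightarrow> has_partials f"
  unfolding smooth_def by (metis cont_diff.simps(2))

lemma smooth_partial: "smooth f \<Longrightarrow> smooth (partial i f)"
  unfolding smooth_def by (metis cont_diff.simps(2))

lemma has_vector_derivative_partial:
  assumes "has_partials f"
  shows "((\<lambda>t. f (x + t *\<^sub>R axis i 1)) has_vector_derivative partial i f x) (at 0)"
  using assms by (auto simp: has_partials_def partial_def vector_derivative_works)

text \<open>Both existence and value of the partial derivatives are read off from derivatives along the
  coordinate directions.\<close>

lemma partials_eqI:
  assumes "\<And>i x. ((\<lambda>t. f (x + t *\<^sub>R axis i 1)) has_vector_derivative g i x) (at 0)"
  shows "has_partials f" and "partial i f = g i"
  using assms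
  by (auto simp: has_partials_def partial_def fun_eq_iff
      intro: differentiableI_vector vector_derivative_at)

lemma cont_diff_Suc_D: "cont_diff (Suc k) f \<Longrightarrow> cont_diff k f"
  by (induction k arbitrary: f) auto

lemma cont_diff_add: "cont_diff k f \<Longrightarrow> cont_diff k g \<Longrightarrow> cont_diff k (\<lambda>x. f x + g x)"
proof (induction k arbitrary: f g)
  case (Suc k)
  have "((\<lambda>t. f (x + t *\<^sub>R axis i 1) + g (x + t *\<^sub>R axis i 1))
      has_vector_derivative partial i f x + partial i g x) (at 0)" for i x
    using Suc.prems
    by (intro has_vector_derivative_add has_vector_derivative_partial) auto
  note p = partials_eqI[where f = "\<lambda>x. f x + g x", OF this]
  show ?case
    using Suc by (auto simp: p intro: continuous_intros)
qed (auto intro: continuous_intros)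

lemma cont_diff_mult: "cont_diff k f \<Longrightarrow> cont_diff k g \<Longrightarrow> cont_diff k (\<lambda>x. f x * g x)"
proof (induction k arbitrary: f g)
  case (Suc k)
  have "((\<lambda>t. f (x + t *\<^sub>R axis i 1) * g (x + t *\<^sub>R axis i 1))
      has_vector_derivative f x * partial i g x + partial i f x * g x) (at 0)" for i x
    using has_vector_derivative_mult[of "\<lambda>t. f (x + t *\<^sub>R axis i 1)" "partial i f x" 0 UNIV
        "\<lambda>t. g (x + t *\<^sub>R axis i 1)" "partial i g x"] Suc.prems
    by (auto simp: has_vector_derivative_partial)
  note p = partials_eqI[where f = "\<lambda>x. f x * g x", OF this]
  have "cont_diff k f" "cont_diff k g"
    using Suc.prems by (blast intro: cont_diff_Suc_D)+
  then show ?case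
    using Suc.prems by (auto simp: p intro!: continuous_intros cont_diff_add Suc.IH)
qed (auto intro: continuous_intros)

lemma smooth_add: "smooth f \<Longrightarrow> smooth g \<Longrightarrow> smooth (\<lambda>x. f x + g x)"
  by (auto simp: smooth_def cont_diff_add)

lemma smooth_mult: "smooth f \<Longrightarrow> smooth g \<Longrightarrow> smooth (\<lambda>x. f x * g x)"
  by (auto simp: smooth_def cont_diff_mult)

lemma smooth_const: "smooth (\<lambda>_ :: real ^ 'n::finite. c)"
proof (rule smooth_coinduct[where P = "\<lambda>f. \<exists>c. f = (\<lambda>_. c)"])
  fix f :: "real ^ 'n \<Rightarrow> complex" assume "\<exists>c. f = (\<lambda>_. c)"
  then obtain c where f: "f = (\<lambda>_. c)" by blast
  have "((\<lambda>t. f (x + t *\<^sub>R axis i 1)) has_vector_derivative 0) (at 0)" for i x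
    by (simp add: f)
  note p = partials_eqI[where f = f and g = "\<lambda>_ _. 0", OF this]
  show "continuous_on UNIV f \<and> has_partials f \<and> (\<forall>i. \<exists>c. partial i f = (\<lambda>_. c))"
    using p by (auto simp: f)
qed auto

lemma smooth_prod:
  assumes "finite A" "\<And>i. i \<in> A \<Longrightarrow> smooth (f i)"
  shows "smooth (\<lambda>x. \<Prod>i\<in>A. f i x)"
  using assms by (induction A rule: finite_induct) (auto intro: smooth_const smooth_mult)

text \<open>The chain rule in the direction of a coordinate axis; each derivative of a function rescaled by
  \<open>s\<close> contributes one factor \<open>s\<close>. Keeping the prefactor \<open>c\<close> makes the shape stable under
  iteration.\<close>

lemma partial_scale:
  assumes "has_partials f"
  shows "((\<lambda>t. c * f (s *\<^sub>R (x + t *\<^sub>R axis i 1)))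
    has_vector_derivative c * of_real s * partial i f (s *\<^sub>R x)) (at 0)"
proof -
  have "((\<lambda>u. f (s *\<^sub>R x + u *\<^sub>R axis i 1)) has_vector_derivative partial i f (s *\<^sub>R x)) (at 0)"
    by (rule has_vector_derivative_partial[OF assms])
  moreover have "((\<lambda>t. s * t) has_vector_derivative s) (at 0)"
    by (auto intro!: derivative_eq_intros)
  ultimately have "((\<lambda>u. f (s *\<^sub>R x + u *\<^sub>R axis i 1)) \<circ> (\<lambda>t. s * t)
      has_vector_derivative s *\<^sub>R partial i f (s *\<^sub>R x)) (at 0)"
    by (intro vector_diff_chain_at) auto
  then have "((\<lambda>t. c * f (s *\<^sub>R (x + t *\<^sub>R axis i 1)))
      has_vector_derivative c * (s *\<^sub>R partial i f (s *\<^sub>R x))) (at 0)"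
    by (intro has_vector_derivative_mult_right) (simp add: o_def scaleR_add_right)
  then show ?thesis
    by (simp add: scaleR_conv_of_real mult.assoc)
qed

lemma smooth_scale:
  fixes f :: "real ^ 'n::finite \<Rightarrow> complex"
  assumes "smooth f"
  shows "smooth (\<lambda>x. c * f (s *\<^sub>R x))"
proof (rule smooth_coinduct[where P = "\<lambda>g. \<exists>c f. smooth f \<and> g = (\<lambda>x. c * f (s *\<^sub>R x))"])
  fix g :: "real ^ 'n \<Rightarrow> complex" assume "\<exists>c f. smooth f \<and> g = (\<lambda>x. c * f (s *\<^sub>R x))"
  then obtain c f where f: "smooth f" and g: "g = (\<lambda>x. c * f (s *\<^sub>R x))" by blast
  note p = partials_eqI[where f = g and g = "\<lambda>i x. c * of_real s * partial i f (s *\<^sub>R x)",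
      unfolded g, OF partial_scale[OF smooth_has_partials[OF f]], folded g]
  have "continuous_on UNIV g"
    unfolding g using smooth_continuous[OF f]
    by (auto intro!: continuous_intros continuous_on_compose2[OF smooth_continuous[OF f]])
  then show "continuous_on UNIV g \<and> has_partials g
      \<and> (\<forall>i. \<exists>c f. smooth f \<and> partial i g = (\<lambda>x. c * f (s *\<^sub>R x)))"
    using p smooth_partial[OF f] by blast
qed (use assms in blast)

lemma partial_scale_eq:
  assumes "has_partials f"
  shows "partial i (\<lambda>x. c * f (s *\<^sub>R x)) = (\<lambda>x. c * of_real s * partial i f (s *\<^sub>R x))"
  by (rule partials_eqI(2)[where g = "\<lambda>i x. c * of_real s * partial i f (s *\<^sub>R x)",
      OF partial_scale[OF assms]])

lemma smooth_partial_power: "smooth f \<Longrightarrow> smooth ((partial i ^^ k) f)"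
  by (induction k) (auto intro: smooth_partial)

lemma partial_power_scale:
  assumes "smooth f"
  shows "(partial i ^^ k) (\<lambda>x. c * f (s *\<^sub>R x)) = (\<lambda>x. c * of_real s ^ k * (partial i ^^ k) f (s *\<^sub>R x))"
proof (induction k)
  case (Suc k)
  note sp = smooth_has_partials[OF smooth_partial_power[OF assms]]
  show ?case
    unfolding funpow.simps comp_apply Suc.IH partial_scale_eq[OF sp]
    by (simp add: mult_ac)
qed auto

lemma coords: "distinct (coords :: 'n::finite list)" "set (coords :: 'n list) = UNIV"
  using someI_ex[OF finite_distinct_list[OF finite[of "UNIV :: 'n set"]]]
  unfolding coords_def by (auto simp: conj_commute)

lemma smooth_mpartial:
  assumes "smooth f"
  shows "smooth (mpartial \<alpha> f)"
proof -
  have "smooth (foldr (\<lambda>i. partial i ^^ \<alpha> i) is f)" for "is"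
    by (induction "is") (auto simp: assms smooth_partial_power)
  then show ?thesis by (simp add: mpartial_def)
qed

lemma mpartial_scale:
  fixes f :: "real ^ 'n::finite \<Rightarrow> complex"
  assumes "smooth f"
  shows "mpartial \<alpha> (\<lambda>x. c * f (s *\<^sub>R x)) = (\<lambda>x. c * of_real s ^ mdeg \<alpha> * mpartial \<alpha> f (s *\<^sub>R x))"
proof -
  have sm: "smooth (foldr (\<lambda>i. partial i ^^ \<alpha> i) is f)" for "is"
    by (induction "is") (auto simp: assms smooth_partial_power)
  have "foldr (\<lambda>i. partial i ^^ \<alpha> i) is (\<lambda>x. c * f (s *\<^sub>R x)) =
      (\<lambda>x. c * of_real s ^ (\<Sum>i\<leftarrow>is. \<alpha> i) * foldr (\<lambda>i. partial i ^^ \<alpha> i) is f (s *\<^sub>R x))" for "is"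
  proof (induction "is")
    case (Cons i "is")
    show ?case
      unfolding foldr.simps comp_apply Cons.IH partial_power_scale[OF sm]
      by (simp add: power_add mult_ac)
  qed simp
  moreover have "(\<Sum>i\<leftarrow>coords. \<alpha> i) = mdeg \<alpha>"
    unfolding mdeg_def using coords by (metis sum_list_distinct_conv_sum_set)
  ultimately show ?thesis by (simp add: mpartial_def)
qed

text \<open>The complement of the closed set is open, so \<open>f\<close> vanishes on a whole line segment around \<open>x\<close>.\<close>

lemma partial_zero_outside:
  assumes "closed K" "\<And>x. x \<notin> K \<Longrightarrow> f x = 0" "x \<notin> K"
  shows "partial i f x = 0"
proof -
  have "continuous (at 0) (\<lambda>t::real. x + t *\<^sub>R axis i 1)"
    by (intro continuous_intros)
  then have "((\<lambda>t::real. x + t *\<^sub>R axis i 1) \<longlongrightarrow> x) (at 0)"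
    by (simp add: continuous_at)
  then have "\<forall>\<^sub>F t in at 0. x + t *\<^sub>R axis i 1 \<in> - K"
    using assms(1,3) by (intro topological_tendstoD) auto
  then have "\<forall>\<^sub>F t in nhds 0. (\<lambda>t. f (x + t *\<^sub>R axis i 1)) t = (\<lambda>_. 0) t"
    using assms(2,3) by (auto simp: eventually_at_filter elim!: eventually_mono)
  then have "((\<lambda>t. f (x + t *\<^sub>R axis i 1)) has_vector_derivative 0) (at 0)"
    by (subst has_vector_derivative_cong_ev) (use assms in auto)
  then show ?thesis
    by (simp add: partial_def vector_derivative_at)
qed

lemma mpartial_zero_outside:
  assumes "closed K" "\<And>x. x \<notin> K \<Longrightarrow> f x = 0" "x \<notin> K"
  shows "mpartial \<alpha> f x = 0"
proof -
  have power: "(partial i ^^ k) g x = 0" if "\<And>x. x \<notin> K \<Longrightarrow> g x = 0" "x \<notin> K" for i k g x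
    using that(2) by (induction k arbitrary: x) (auto simp: that(1) partial_zero_outside[OF assms(1)])
  have "foldr (\<lambda>i. partial i ^^ \<alpha> i) is f x = 0" if "x \<notin> K" for x "is"
    using that by (induction "is" arbitrary: x) (auto simp: assms(2) power)
  then show ?thesis
    using assms(3) by (simp add: mpartial_def)
qed

text \<open>The derivative is continuous and vanishes outside the compact set on which \<open>f\<close> lives. Without
  boundedness the supremum in the growth condition of a delta function would carry no information.\<close>

lemma mpartial_bounded:
  assumes "smooth f" "compact K" "\<And>x. x \<notin> K \<Longrightarrow> f x = 0"
  shows "bounded (range (mpartial \<alpha> f))"
proof -
  have "bounded (mpartial \<alpha> f ` K)"
    using assms smooth_continuous[OF smooth_mpartial]
    by (intro compact_imp_bounded compact_continuous_image) (auto intro: continuous_on_subset)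
  moreover have "range (mpartial \<alpha> f) \<subseteq> insert 0 (mpartial \<alpha> f ` K)"
    using mpartial_zero_outside[OF compact_imp_closed[OF assms(2)], of f] assms(3) by blast
  ultimately show ?thesis
    by (meson bounded_insert bounded_subset)
qed

lemma test_function_iff:
  "f \<in> test_functions \<longleftrightarrow> smooth f \<and> bounded {x. f x \<noteq> 0}"
  by (simp add: test_functions_def smooth_def compact_closure)

section \<open>A bump function\<close>

text \<open>The derivatives of \<open>exp (- 1 / t)\<close>, extended by \<open>0\<close> to \<open>t \<le> 0\<close>, are polynomials in \<open>1 / t\<close> times
  the same exponential. Taking the polynomial as a parameter gives a class that is closed under
  differentiation.\<close>

definition flat :: "real poly \<Rightarrow> real \<Rightarrow> real" where
  "flat p t = (if t > 0 then poly p (inverse t) * exp (- inverse t) else 0)"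

definition flat_deriv :: "real poly \<Rightarrow> real poly" where
  "flat_deriv p = [:0, 0, 1:] * (p - pderiv p)"

lemma tendsto_poly_exp: "((\<lambda>u. poly p u * exp (- u)) \<longlongrightarrow> (0::real)) at_top"
proof -
  have "((\<lambda>u. \<Sum>i\<le>degree p. coeff p i * (u ^ i / exp u)) \<longlongrightarrow> (\<Sum>i\<le>degree p. coeff p i * 0)) at_top"
    by (intro tendsto_intros tendsto_power_div_exp_0)
  then show ?thesis
    by (simp add: poly_altdef sum_distrib_right exp_minus divide_inverse mult.assoc)
qed

text \<open>Away from \<open>0\<close> this is a computation. At \<open>0\<close> the difference quotient is again a polynomial in
  \<open>1 / t\<close> times \<open>exp (- 1 / t)\<close>, which tends to \<open>0\<close> because the exponential beats every
  polynomial.\<close>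

lemma flat_has_derivative: "(flat p has_real_derivative flat (flat_deriv p) t) (at t)"
proof -
  consider "t > 0" | "t < 0" | "t = 0" by linarith
  then show ?thesis
  proof cases
    case 1
    have "((\<lambda>t. poly p (inverse t) * exp (- inverse t)) has_real_derivative
        flat (flat_deriv p) t) (at t)"
      using 1 by (auto intro!: derivative_eq_intros DERIV_chain2[OF poly_DERIV]
          simp: flat_def flat_deriv_def power2_eq_square algebra_simps)
    then show ?thesis
      using 1 by (rule has_field_derivative_transform_within[where d = t])
        (auto simp: flat_def dist_real_def)
  next
    case 2
    have "((\<lambda>_. 0) has_real_derivative flat (flat_deriv p) t) (at t)"
      using 2 by (auto simp: flat_def)
    then show ?thesis
      by (rule has_field_derivative_transform_within[where d = "- t"])
        (use 2 in \<open>auto simp: flat_def dist_real_def\<close>)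
  next
    case 3
    have "((\<lambda>h. poly ([:0, 1:] * p) (inverse h) * exp (- inverse h)) \<longlongrightarrow> 0) (at_right 0)"
      using filterlim_compose[OF tendsto_poly_exp filterlim_inverse_at_top_right] .
    moreover have "\<forall>\<^sub>F h in at_right 0.
        poly ([:0, 1:] * p) (inverse h) * exp (- inverse h) = flat p h / h"
      by (auto simp: eventually_at_filter flat_def divide_inverse)
    ultimately have "((\<lambda>h. flat p h / h) \<longlongrightarrow> 0) (at_right 0)"
      by (rule Lim_transform_eventually)
    moreover have "((\<lambda>h. flat p h / h) \<longlongrightarrow> 0) (at_left 0)"
      by (rule tendsto_eventually) (auto simp: eventually_at_filter flat_def)
    ultimately have "((\<lambda>h. flat p h / h) \<longlongrightarrow> 0) (at 0)"
      by (simp add: filterlim_split_at)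
    then show ?thesis
      by (simp add: 3 has_field_derivative_iff flat_def)
  qed
qed

lemma smooth_flat_coordinate: "smooth (\<lambda>x :: real ^ 'n::finite. complex_of_real (flat p (a + s * x $ i)))"
proof (rule smooth_coinduct[where
      P = "\<lambda>f. \<exists>p. f = (\<lambda>x. complex_of_real (flat p (a + s * x $ i)))"])
  fix f :: "real ^ 'n \<Rightarrow> complex"
  assume "\<exists>p. f = (\<lambda>x. complex_of_real (flat p (a + s * x $ i)))"
  then obtain p where f: "f = (\<lambda>x. complex_of_real (flat p (a + s * x $ i)))" by blast
  \<comment> \<open>The derivative in a direction other than \<open>i\<close> is zero, which is the flat function of the zero polynomial.\<close>
  define q where "q j = (if j = i then smult s (flat_deriv p) else 0)" for j
  have "((\<lambda>t. complex_of_real (flat p (a + s * (x + t *\<^sub>R axis j 1) $ i)))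
      has_vector_derivative complex_of_real (flat (q j) (a + s * x $ i))) (at 0)" for j x
  proof -
    have "((\<lambda>t. a + s * (x + t *\<^sub>R axis j 1) $ i) has_real_derivative (if j = i then s else 0)) (at 0)"
      by (auto intro!: derivative_eq_intros simp: axis_def)
    from DERIV_chain2[OF flat_has_derivative this, of p]
    have "((\<lambda>t. flat p (a + s * (x + t *\<^sub>R axis j 1) $ i)) has_real_derivative
        flat (q j) (a + s * x $ i)) (at 0)"
      by (rule DERIV_cong) (auto simp: q_def flat_def)
    then show ?thesis
      by (rule has_vector_derivative_of_real)
  qed
  then have d: "((\<lambda>t. f (x + t *\<^sub>R axis j 1))
      has_vector_derivative complex_of_real (flat (q j) (a + s * x $ i))) (at 0)" for j x
    by (simp only: f)
  have p: "has_partials f" "\<And>j. partial j f = (\<lambda>x. complex_of_real (flat (q j) (a + s * x $ i)))"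
    by (rule partials_eqI[where g = "\<lambda>j x. complex_of_real (flat (q j) (a + s * x $ i))", OF d])+
  have "continuous_on UNIV (flat p)"
    by (meson DERIV_isCont continuous_at_imp_continuous_on flat_has_derivative)
  then have "continuous_on UNIV (\<lambda>x. flat p (a + s * x $ i))"
    by (rule continuous_on_compose2) (auto intro!: continuous_intros)
  then have "continuous_on UNIV f"
    unfolding f by (rule continuous_on_of_real)
  moreover have "\<exists>p. partial j f = (\<lambda>x. complex_of_real (flat p (a + s * x $ i)))" for j
    by (rule exI, rule p(2))
  ultimately show "continuous_on UNIV f \<and> has_partials f
      \<and> (\<forall>j. \<exists>p. partial j f = (\<lambda>x. complex_of_real (flat p (a + s * x $ i))))"
    using p(1) by (intro conjI allI)
qed blast

text \<open>The factor for coordinate \<open>i\<close> is supported where \<open>\<bar>x\<^sub>i\<bar> \<le> 1/d\<close>; since the Euclidean norm is at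
  most the sum of the \<open>\<bar>x\<^sub>i\<bar>\<close>, this puts the support of the product into the unit ball. Using both
  signs of \<open>x\<^sub>i\<close> makes the product symmetric.\<close>

definition bump :: "real ^ 'n::finite \<Rightarrow> real" where
  "bump x = (\<Prod>i\<in>UNIV. flat 1 (1 / CARD('n) + x $ i) * flat 1 (1 / CARD('n) - x $ i))"

lemma smooth_bump: "smooth (\<lambda>x :: real ^ 'n::finite. complex_of_real (bump x))"
  using smooth_flat_coordinate[of 1 "1 / CARD('n)" "-1"] smooth_flat_coordinate[of 1 "1 / CARD('n)" 1]
  by (auto simp: bump_def intro!: smooth_prod smooth_mult)

lemma bump_nonneg: "bump x \<ge> 0"
  by (auto simp: bump_def flat_def intro!: prod_nonneg)

lemma bump_minus: "bump (- x) = bump x"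
  by (simp add: bump_def mult.commute)

lemma bump_zero_pos: "bump 0 > 0"
  by (auto simp: bump_def flat_def intro!: prod_pos)

lemma bump_eq_0:
  fixes x :: "real ^ 'n::finite"
  assumes "norm x \<ge> 1"
  shows "bump x = 0"
proof -
  have "\<exists>i. \<bar>x $ i\<bar> \<ge> 1 / CARD('n)"
  proof (rule ccontr)
    assume "\<not> ?thesis"
    then have "(\<Sum>i\<in>UNIV. \<bar>x $ i\<bar>) < (\<Sum>i\<in>(UNIV :: 'n set). 1 / CARD('n))"
      by (intro sum_strict_mono) (auto simp: not_le)
    with norm_le_l1_cart[of x] assms show False by simp
  qed
  then obtain i where "\<bar>x $ i\<bar> \<ge> 1 / CARD('n)" ..
  then have "flat 1 (1 / CARD('n) + x $ i) * flat 1 (1 / CARD('n) - x $ i) = 0"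
    by (auto simp: flat_def)
  then show ?thesis
    unfolding bump_def by (intro prod_zero) auto
qed

section \<open>Mollifiers with vanishing moments\<close>

lemma integrable_compact_support:
  fixes f :: "real ^ 'n::finite \<Rightarrow> 'b::{banach, second_countable_topology}"
  assumes "continuous_on UNIV f" "compact K" "\<And>x. x \<notin> K \<Longrightarrow> f x = 0"
  shows "integrable lebesgue f"
proof -
  have "(\<lambda>x. indicator K x *\<^sub>R f x) = f"
    using assms(3) by (auto simp: fun_eq_iff indicator_def)
  then have "integrable lborel f"
    using borel_integrable_compact[OF assms(2), of f] assms(1) continuous_on_subset by fastforce
  then show ?thesis
    using assms(1) by (simp add: integrable_completion borel_measurable_continuous_onI)
qed

text \<open>Linear substitution in the integral, derived for Borel measurable integrands from the behaviour of
  Borel-Lebesgue measure under homotheties and carried over to its completion.\<close>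

lemma integral_scale:
  fixes f :: "real ^ 'n::finite \<Rightarrow> 'b::{banach, second_countable_topology}"
  assumes "continuous_on UNIV f" "q > 0"
  shows "(LINT x|lebesgue. f ((1 / q) *\<^sub>R x)) = q ^ CARD('n) *\<^sub>R (LINT x|lebesgue. f x)"
proof -
  have m: "f \<in> borel_measurable borel"
    using assms(1) by (rule borel_measurable_continuous_onI)
  have m': "(\<lambda>x. f ((1 / q) *\<^sub>R x)) \<in> borel_measurable borel"
    using m by measurable
  have "(LINT x|lborel. f ((1 / q) *\<^sub>R x)) =
      integral\<^sup>L (density (distr lborel borel (\<lambda>x. 0 + q *\<^sub>R x)) (\<lambda>_. ennreal (\<bar>q\<bar> ^ CARD('n))))
        (\<lambda>x. f ((1 / q) *\<^sub>R x))"
    using lborel_affine[of q "0 :: real ^ 'n"] assms(2) by (simp add: ennreal_power)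
  also have "\<dots> = q ^ CARD('n) *\<^sub>R (LINT x|lborel. f x)"
    using m m' assms(2) by (subst integral_density) (auto simp: integral_distr)
  finally show ?thesis
    using m m' by (simp add: integral_completion)
qed

lemma mono_pow_scale: "mono_pow (s *\<^sub>R x) \<alpha> = s ^ mdeg \<alpha> * mono_pow x \<alpha>"
  by (simp add: mono_pow_def mdeg_def power_mult_distrib prod.distrib power_sum)

lemma continuous_mono_pow: "continuous_on UNIV (\<lambda>x. mono_pow x \<alpha>)"
  unfolding mono_pow_def by (intro continuous_intros)

lemma mdeg_eq_0_iff: "mdeg \<alpha> = 0 \<longleftrightarrow> \<alpha> = (\<lambda>_. 0)"
  by (auto simp: mdeg_def fun_eq_iff)

abbreviation moment :: "(real ^ 'n::finite \<Rightarrow> complex) \<Rightarrow> ('n \<Rightarrow> nat) \<Rightarrow> complex" where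
  "moment f \<alpha> \<equiv> LINT x|lebesgue. f x * complex_of_real (mono_pow x \<alpha>)"

abbreviation L1_norm :: "(real ^ 'n::finite \<Rightarrow> complex) \<Rightarrow> real" where
  "L1_norm f \<equiv> LINT x|lebesgue. cmod (f x)"

text \<open>The conditions on a delta function of radius \<open>r\<close> that involve neither higher moments nor an
  infinitesimal.\<close>

definition mollifier :: "real \<Rightarrow> (real ^ 'n::finite \<Rightarrow> complex) \<Rightarrow> bool" where
  "mollifier r f \<longleftrightarrow> smooth f \<and> range f \<subseteq> \<real> \<and> (\<forall>x. f (- x) = f x) \<and>
    (\<forall>x. norm x \<ge> r \<longrightarrow> f x = 0) \<and> (LINT x|lebesgue. f x) = 1"

text \<open>The normalisation preserves integrals and \<open>L\<^sup>1\<close> norms.\<close>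

definition rescale :: "real \<Rightarrow> (real ^ 'n::finite \<Rightarrow> complex) \<Rightarrow> real ^ 'n \<Rightarrow> complex" where
  "rescale q f x = complex_of_real (1 / q ^ CARD('n)) * f ((1 / q) *\<^sub>R x)"

lemma mollifier_integrable:
  assumes "mollifier r f"
  shows "integrable lebesgue f"
    and "integrable lebesgue (\<lambda>x. f x * complex_of_real (mono_pow x \<alpha>))"
    and "integrable lebesgue (\<lambda>x. cmod (f x))"
proof -
  have "continuous_on UNIV f" "\<And>x. x \<notin> cball 0 r \<Longrightarrow> f x = 0"
    using assms by (auto simp: mollifier_def smooth_continuous dist_norm)
  then show "integrable lebesgue f"
    and "integrable lebesgue (\<lambda>x. f x * complex_of_real (mono_pow x \<alpha>))"
    and "integrable lebesgue (\<lambda>x. cmod (f x))"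
    by (auto intro!: integrable_compact_support[where K = "cball 0 r"] continuous_intros
        continuous_mono_pow)
qed

lemma rescale_mollifier:
  fixes f :: "real ^ 'n::finite \<Rightarrow> complex"
  assumes f: "mollifier r f" and q: "q > 0"
  shows "mollifier (q * r) (rescale q f)"
    and "moment (rescale q f) \<alpha> = of_real q ^ mdeg \<alpha> * moment f \<alpha>"
    and "L1_norm (rescale q f) = L1_norm f"
proof -
  have sm: "smooth f" using f by (simp add: mollifier_def)
  have cont: "continuous_on UNIV f" using sm by (rule smooth_continuous)
  have "smooth (rescale q f)"
    unfolding rescale_def[abs_def] by (rule smooth_scale[OF sm])
  moreover have "(LINT x|lebesgue. rescale q f x) = 1"
    using integral_scale[OF cont q] f q
    by (simp add: rescale_def mollifier_def scaleR_conv_of_real)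
  moreover have "rescale q f x = 0" if "q * r \<le> norm x" for x
  proof -
    have "r \<le> norm ((1 / q) *\<^sub>R x)"
      using q that by (simp add: field_simps)
    then have "f ((1 / q) *\<^sub>R x) = 0"
      using f unfolding mollifier_def by blast
    then show ?thesis by (simp only: rescale_def mult_zero_right)
  qed
  moreover have "rescale q f (- x) = rescale q f x" for x
    using f by (simp add: rescale_def mollifier_def)
  moreover have "rescale q f x \<in> \<real>" for x
    using f unfolding rescale_def mollifier_def by (intro Reals_mult) auto
  ultimately show "mollifier (q * r) (rescale q f)"
    unfolding mollifier_def by blast
  have "rescale q f x * complex_of_real (mono_pow x \<alpha>) = complex_of_real (q ^ mdeg \<alpha> / q ^ CARD('n)) *
     (f ((1 / q) *\<^sub>R x) * complex_of_real (mono_pow ((1 / q) *\<^sub>R x) \<alpha>))" for x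
    using q by (simp add: rescale_def mono_pow_scale power_one_over field_simps)
  then show "moment (rescale q f) \<alpha> = of_real q ^ mdeg \<alpha> * moment f \<alpha>"
    using integral_scale[OF continuous_on_mult[OF cont continuous_on_of_real[OF continuous_mono_pow]] q] q
    by (simp add: scaleR_conv_of_real)
  have "cmod (rescale q f x) = 1 / q ^ CARD('n) * cmod (f ((1 / q) *\<^sub>R x))" for x
    using q by (simp add: rescale_def norm_mult norm_divide norm_power)
  then show "L1_norm (rescale q f) = L1_norm f"
    using integral_scale[OF continuous_on_norm[OF cont] q] q by simp
qed

text \<open>The combination is affine rather than convex: one of the coefficients is going to be negative, which
  is what allows moments to cancel and what makes the \<open>L\<^sup>1\<close> norm exceed \<open>1\<close>.\<close>

lemma mollifier_affine_combination:
  assumes f: "mollifier 1 f" and g: "mollifier 1 g" and ab: "a + b = (1 :: real)"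
  defines "h \<equiv> \<lambda>x. of_real a * f x + of_real b * g x"
  shows "mollifier 1 h"
    and "moment h \<alpha> = of_real a * moment f \<alpha> + of_real b * moment g \<alpha>"
    and "L1_norm h \<le> \<bar>a\<bar> * L1_norm f + \<bar>b\<bar> * L1_norm g"
proof -
  note int = mollifier_integrable[OF f] mollifier_integrable[OF g]
  have "smooth h"
    using f g unfolding h_def mollifier_def by (auto intro!: smooth_add smooth_mult smooth_const)
  moreover have "(LINT x|lebesgue. h x) = of_real (a + b)"
    using f g int by (simp add: h_def mollifier_def)
  moreover have "h x \<in> \<real>" for x
    using f g unfolding h_def mollifier_def by (auto intro!: Reals_add Reals_mult)
  ultimately show h: "mollifier 1 h"
    using f g ab unfolding mollifier_def by (auto simp: h_def)
  show "moment h \<alpha> = of_real a * moment f \<alpha> + of_real b * moment g \<alpha>"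
    using int by (simp add: h_def distrib_right mult.assoc)
  have "L1_norm h \<le> (LINT x|lebesgue. \<bar>a\<bar> * cmod (f x) + \<bar>b\<bar> * cmod (g x))"
    using int mollifier_integrable[OF h]
    by (intro integral_mono) (auto simp: h_def norm_mult intro: norm_triangle_le)
  also have "\<dots> = \<bar>a\<bar> * L1_norm f + \<bar>b\<bar> * L1_norm g"
    using int by simp
  finally show "L1_norm h \<le> \<bar>a\<bar> * L1_norm f + \<bar>b\<bar> * L1_norm g" .
qed

lemma ex_nonneg_mollifier: "\<exists>f :: real ^ 'n::finite \<Rightarrow> complex. mollifier 1 f \<and> L1_norm f = 1"
proof -
  let ?b = "bump :: real ^ 'n \<Rightarrow> real"
  define c where "c = (LINT x|lebesgue. ?b x)"
  have "continuous_on UNIV (\<lambda>x. Re (of_real (?b x)))"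
    by (intro continuous_intros smooth_continuous[OF smooth_bump])
  then have cont: "continuous_on UNIV ?b"
    by simp
  have int: "integrable lebesgue ?b"
    using cont by (rule integrable_compact_support[where K = "cball 0 1"]) (auto simp: bump_eq_0)
  \<comment> \<open>The bump is positive on a nonempty open set, so its integral cannot vanish.\<close>
  have "\<not> (AE x in lebesgue. ?b x = 0)"
  proof
    assume "AE x in lebesgue. ?b x = 0"
    then have "negligible {x. ?b x \<noteq> 0}"
      by (auto simp: negligible_iff_null_sets completion.AE_iff_null_sets)
    then have "negligible {x. ?b x > 0}"
      by (rule negligible_subset) auto
    moreover have "open {x. ?b x > 0}"
      using cont by (intro open_Collect_less) auto
    ultimately show False
      using open_not_negligible bump_zero_pos by blast
  qed
  then have "c \<noteq> 0"
    unfolding c_def using int by (subst integral_nonneg_eq_0_iff_AE) (auto simp: bump_nonneg)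
  moreover have "c \<ge> 0"
    unfolding c_def by (auto simp: bump_nonneg)
  ultimately have c: "c > 0" by simp
  define f where "f = (\<lambda>x. complex_of_real (1 / c) * of_real (?b x))"
  have "smooth f"
    unfolding f_def by (intro smooth_mult smooth_const smooth_bump)
  moreover have "(LINT x|lebesgue. f x) = of_real (1 / c) * of_real c"
    using int unfolding f_def c_def by (simp add: integral_complex_of_real)
  ultimately have "mollifier 1 f"
    using c unfolding mollifier_def by (auto simp: f_def bump_minus bump_eq_0)
  moreover have "cmod (f x) = ?b x / c" for x
    using c by (simp add: f_def norm_mult norm_divide bump_nonneg)
  then have "L1_norm f = 1"
    using c int by (simp add: c_def)
  ultimately show ?thesis by blast
qed

text \<open>The induction step combines a mollifier \<open>f\<close> with its rescaling by \<open>q\<close>, with the coefficients chosen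
  so that the moments of order \<open>n + 1\<close>, which differ by the factor \<open>t = q\<^bsup>n+1\<^esup>\<close>, cancel. The bound on the
  \<open>L\<^sup>1\<close> norm is arbitrary at every stage, and each step spends half of the allowance on the
  mollifier it starts from.\<close>

lemma ex_vanishing_moments:
  assumes "\<epsilon> > 0"
  shows "\<exists>f :: real ^ 'n::finite \<Rightarrow> complex. mollifier 1 f \<and> L1_norm f < 1 + \<epsilon> \<and>
    (\<forall>\<alpha>. \<alpha> \<noteq> (\<lambda>_. 0) \<longrightarrow> mdeg \<alpha> \<le> n \<longrightarrow> moment f \<alpha> = 0)"
  using assms
proof (induction n arbitrary: \<epsilon>)
  case 0
  then show ?case
    using ex_nonneg_mollifier by (fastforce simp: mdeg_eq_0_iff)
next
  case (Suc n)
  obtain f :: "real ^ 'n \<Rightarrow> complex" where f: "mollifier 1 f" "L1_norm f < 1 + \<epsilon> / 2"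
    "\<And>\<alpha>. \<alpha> \<noteq> (\<lambda>_. 0) \<Longrightarrow> mdeg \<alpha> \<le> n \<Longrightarrow> moment f \<alpha> = 0"
    using Suc.IH[of "\<epsilon> / 2"] Suc.prems by auto
  \<comment> \<open>Choose \<open>t\<close> so small that the loss factor \<open>(1 + t) / (1 - t)\<close> fits into the remaining allowance.\<close>
  have "((\<lambda>t. (1 + t) / (1 - t) * (1 + \<epsilon> / 2)) \<longlongrightarrow> (1 + 0) / (1 - 0) * (1 + \<epsilon> / 2)) (at_right 0)"
    by (intro tendsto_intros) auto
  then have "\<forall>\<^sub>F t in at_right 0. (1 + t) / (1 - t) * (1 + \<epsilon> / 2) < 1 + \<epsilon>"
    by (rule order_tendstoD) (use Suc.prems in auto)
  moreover have "\<forall>\<^sub>F t in at_right 0. t < (1 :: real)"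
    by (rule eventually_at_rightI[of 0 1]) auto
  moreover have "\<forall>\<^sub>F t in at_right 0. t > (0 :: real)"
    by (rule eventually_at_right_less)
  ultimately have "\<forall>\<^sub>F t in at_right 0. 0 < t \<and> t < 1 \<and> (1 + t) / (1 - t) * (1 + \<epsilon> / 2) < 1 + \<epsilon>"
    by eventually_elim auto
  then obtain t where t: "0 < t" "t < 1" "(1 + t) / (1 - t) * (1 + \<epsilon> / 2) < 1 + \<epsilon>"
    using eventually_happens trivial_limit_at_right_real by blast
  define q where "q = root (Suc n) t"
  have q: "0 < q" "q < 1" "q ^ Suc n = t"
    using t real_root_pow_pos2[of "Suc n" t] by (auto simp: q_def simp del: power_Suc)
  note g = rescale_mollifier[OF f(1) q(1)]
  have g1: "mollifier 1 (rescale q f)"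
    using g(1) q(2) by (auto simp: mollifier_def)
  define h where "h x = of_real (1 / (1 - t)) * rescale q f x + of_real (- t / (1 - t)) * f x" for x
  have "1 / (1 - t) + - t / (1 - t) = 1"
    using t by (simp add: field_simps)
  note h = mollifier_affine_combination[OF g1 f(1) this, folded h_def]
  have "L1_norm h \<le> \<bar>1 / (1 - t)\<bar> * L1_norm f + \<bar>- t / (1 - t)\<bar> * L1_norm f"
    using h(3) g(3) by simp
  also have "\<dots> = (1 + t) / (1 - t) * L1_norm f"
    using t by (simp add: add_divide_distrib distrib_right)
  also have "\<dots> \<le> (1 + t) / (1 - t) * (1 + \<epsilon> / 2)"
    using t f(2) by (intro mult_left_mono) auto
  finally have "L1_norm h < 1 + \<epsilon>"
    using t(3) by simp
  moreover have "moment h \<alpha> = 0" if "\<alpha> \<noteq> (\<lambda>_. 0)" "mdeg \<alpha> \<le> Suc n" for \<alpha>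
  proof (cases "mdeg \<alpha> = Suc n")
    case True
    then have "moment (rescale q f) \<alpha> = of_real t * moment f \<alpha>"
      unfolding g(2) q(3)[symmetric] by simp
    then show ?thesis
      unfolding h(2) by (simp add: field_simps)
  next
    case False
    then show ?thesis
      using f(3)[of \<alpha>] that unfolding h(2) g(2) by simp
  qed
  ultimately show ?case
    using h(1) by blast
qed

section \<open>Transfer\<close>

text \<open>The quantified variables are \<open>0, \<dots>, n - 1\<close>; those from \<open>n\<close> on remain parameters.\<close>

primrec for_all :: "nat \<Rightarrow> 'r fm \<Rightarrow> 'r fm" where
  "for_all 0 p = p"
| "for_all (Suc n) p = FNot (FEx n (FNot (for_all n p)))"

text \<open>Quantifying one variable after the other amounts to replacing the whole initial part of the
  assignment at once.\<close>

lemma sat_for_all: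
  "sat I (for_all n p) e \<longleftrightarrow> (\<forall>e'. (\<forall>m\<ge>n. e' m = e m) \<longrightarrow> sat I p e')"
proof (induction n arbitrary: e)
  case 0
  have "(\<forall>m. e' m = e m) \<longleftrightarrow> e' = e" for e'
    by auto
  then show ?case by simp
next
  case (Suc n)
  have eq: "(\<exists>a. \<forall>m\<ge>n. e' m = (e(n := a)) m) \<longleftrightarrow> (\<forall>m\<ge>Suc n. e' m = e m)" for e'
  proof
    assume "\<exists>a. \<forall>m\<ge>n. e' m = (e(n := a)) m"
    then show "\<forall>m\<ge>Suc n. e' m = e m" by fastforce
  next
    assume "\<forall>m\<ge>Suc n. e' m = e m"
    then have "\<forall>m\<ge>n. e' m = (e(n := e' n)) m"
      by (metis fun_upd_other fun_upd_same le_eq_less_or_eq Suc_leI)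
    then show "\<exists>a. \<forall>m\<ge>n. e' m = (e(n := a)) m" by blast
  qed
  have "sat I (for_all (Suc n) p) e \<longleftrightarrow>
      (\<forall>e'. (\<exists>a. \<forall>m\<ge>n. e' m = (e(n := a)) m) \<longrightarrow> sat I p e')"
    unfolding for_all.simps sat.simps Suc.IH by blast
  then show ?case
    unfolding eq .
qed

text \<open>Universal closures of such implications suffice to carry every condition on a delta function over to
  the extension, because values of functions can be expressed through graphs and constants through
  singletons.\<close>

fun horn :: "('r \<times> nat list) list \<Rightarrow> 'r \<times> nat list \<Rightarrow> 'r fm" where
  "horn [] (S, ys) = FRel S ys"
| "horn ((R, xs) # ps) c = FNot (FAnd (FRel R xs) (FNot (horn ps c)))"

lemma sat_horn:
  "sat I (horn ps (S, ys)) e \<longleftrightarrow> ((\<forall>(R, xs)\<in>set ps. map e xs \<in> I R) \<longrightarrow> map e ys \<in> I S)"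
  by (induction ps) auto

locale nonstandard_extension =
  fixes star :: "'u \<Rightarrow> 'h" and ext :: "'u list set \<Rightarrow> 'h list set"
  assumes transfer: "transfer_principle star ext"
begin

lemma sat_ext: "sat (\<lambda>R. R) p e \<Longrightarrow> sat ext p (star \<circ> e)"
  using transfer by (auto simp: transfer_principle_def)

text \<open>The form in which transfer is used most: an implication between standard relations passes to their
  extensions. Elements of \<^typ>\<open>'h\<close> are supplied through the assignment \<open>e\<close>, typically \<open>(!) hs\<close> for a list
  \<open>hs\<close>, and the index lists say which of them each relation is applied to.\<close>

lemma transfer_horn:
  fixes ps :: "('u list set \<times> nat list) list" and e :: "nat \<Rightarrow> 'h"
  assumes std: "\<And>e. (\<forall>(R, xs)\<in>set ps. map e xs \<in> R) \<Longrightarrow> map e ys \<in> S"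
    and prems: "\<forall>(R, xs)\<in>set ps. map e xs \<in> ext R"
  shows "map e ys \<in> ext S"
proof -
  \<comment> \<open>Only finitely many variables occur, so quantifying over an initial segment covers all of them.\<close>
  obtain n where n: "\<forall>m \<in> set ys \<union> \<Union> (set ` snd ` set ps). m < n"
    using finite_nat_set_iff_bounded[of "set ys \<union> \<Union> (set ` snd ` set ps)"] by auto
  let ?e' = "\<lambda>m. if m < n then e m else star undefined"
  have "sat (\<lambda>R. R) (for_all n (horn ps (S, ys))) (\<lambda>_. undefined)"
    unfolding sat_for_all sat_horn using std by blast
  from sat_ext[OF this] have "sat ext (horn ps (S, ys)) ?e'"
    unfolding sat_for_all by auto
  moreover have "map ?e' ys = map e ys"
    using n by (auto intro!: map_cong)
  moreover have "map ?e' xs = map e xs" if "(R, xs) \<in> set ps" for R xs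
    using n that by (fastforce intro!: map_cong)
  ultimately show ?thesis
    using prems unfolding sat_horn by (metis (mono_tags, lifting) case_prod_beta prod.collapse)
qed

text \<open>This allows standard constants to enter \<open>transfer_horn\<close> through singleton relations.\<close>

lemma ext_singleton: "[h] \<in> ext {[a]} \<longleftrightarrow> h = star a"
proof
  have "sat ext (FNot (FEx 0 (FAnd (FRel {[a]} [0]) (FNot (FEq 0 1))))) (star \<circ> (\<lambda>_. a))"
    by (rule sat_ext) simp
  then show "h = star a" if "[h] \<in> ext {[a]}"
    using that by simp
  have "sat ext (FRel {[a]} [0]) (star \<circ> (\<lambda>_. a))"
    by (rule sat_ext) simp
  then show "[h] \<in> ext {[a]}" if "h = star a"
    using that by simp
qed

text \<open>The existential part of transfer; it carries solvability at every small standard radius over to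
  solvability at an infinitesimal one.\<close>

lemma ext_projection:
  assumes "[h] \<in> ext {[b] |b. \<exists>a. [a, b] \<in> R}"
  shows "\<exists>k. [k, h] \<in> ext R"
proof -
  let ?p = "FNot (FEx 0 (FAnd (FRel {[b] |b. \<exists>a. [a, b] \<in> R} [0]) (FNot (FEx 1 (FRel R [1, 0])))))"
  have "sat ext ?p (star \<circ> (\<lambda>_. undefined))"
    by (rule sat_ext) (simp, blast)
  then show ?thesis
    using assms by simp
qed

text \<open>The extended graph is functional by transfer, so the definite description in the extension of a
  function is proper and values may be computed by membership in the graph.\<close>

lemma hfun_iff: "hfun ext F h = y \<longleftrightarrow> [h, y] \<in> ext {[a, F a] |a. True}"
proof -
  let ?G = "{[a, F a] |a. True}"
  have "sat ext (FNot (FEx 0 (FNot (FEx 1 (FRel ?G [0, 1]))))) (star \<circ> (\<lambda>_. undefined))"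
    by (rule sat_ext) simp
  then obtain z where z: "[h, z] \<in> ext ?G"
    by auto
  have "sat ext (FNot (FEx 0 (FEx 1 (FEx 2
      (FAnd (FRel ?G [0, 1]) (FAnd (FRel ?G [0, 2]) (FNot (FEq 1 2)))))))) (star \<circ> (\<lambda>_. undefined))"
    by (rule sat_ext) simp
  then have "z = z'" if "[h, z'] \<in> ext ?G" for z'
    using z that by auto
  then show ?thesis
    using z unfolding hfun_def by (metis (mono_tags, lifting) the_equality)
qed

lemma hfun2_iff: "hfun2 ext F h k = y \<longleftrightarrow> [h, k, y] \<in> ext {[a, b, F a b] |a b. True}"
proof -
  let ?G = "{[a, b, F a b] |a b. True}"
  have "sat ext (FNot (FEx 0 (FEx 1 (FNot (FEx 2 (FRel ?G [0, 1, 2])))))) (star \<circ> (\<lambda>_. undefined))"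
    by (rule sat_ext) simp
  then obtain z where z: "[h, k, z] \<in> ext ?G"
    by auto
  have "sat ext (FNot (FEx 0 (FEx 1 (FEx 2 (FEx 3
      (FAnd (FRel ?G [0, 1, 2]) (FAnd (FRel ?G [0, 1, 3]) (FNot (FEq 2 3)))))))))
      (star \<circ> (\<lambda>_. undefined))"
    by (rule sat_ext) simp
  then have "z = z'" if "[h, k, z'] \<in> ext ?G" for z'
    using z that by auto
  then show ?thesis
    using z unfolding hfun2_def by (metis (mono_tags, lifting) the_equality)
qed

text \<open>A functional of the test function alone may be regarded as one of radius and test function, so that
  both kinds of infinitesimality conditions are transferred by one argument.\<close>

lemma hfun2_const: "hfun2 ext (\<lambda>_. F) k h = hfun ext F h"
proof -
  have "[h, hfun ext F h] \<in> ext {[a, F a] |a. True}"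
    using hfun_iff by blast
  then have "map ((!) [h, k, hfun ext F h]) [1, 0, 2] \<in> ext {[a, b, F b] |a b. True}"
    by (intro transfer_horn[where ps = "[({[a, F a] |a. True}, [0, 2])]"], force, simp)
  then show ?thesis
    by (simp add: hfun2_iff)
qed

end

section \<open>Approximate delta functions at a standard radius\<close>

text \<open>The standard counterpart of a delta function, cut off at level \<open>n\<close>: only multiindices up to
  order \<open>n\<close> are considered, and \<open>1/(n+1)\<close> replaces being infinitesimal.\<close>

definition approximate_delta :: "nat \<Rightarrow> real \<Rightarrow> (real ^ 'n::finite \<Rightarrow> complex) \<Rightarrow> bool" where
  "approximate_delta n r f \<longleftrightarrow> mollifier r f \<and>
    (\<forall>\<alpha>. \<alpha> \<noteq> (\<lambda>_. 0) \<longrightarrow> mdeg \<alpha> \<le> n \<longrightarrow> moment f \<alpha> = 0) \<and>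
    \<bar>L1_norm f - 1\<bar> < 1 / Suc n \<and>
    (\<forall>\<alpha>. mdeg \<alpha> \<le> n \<longrightarrow>
      \<bar>inverse \<bar>ln r\<bar> * (r ^ (CARD('n) + mdeg \<alpha>) * (SUP x. cmod (mpartial \<alpha> f x)))\<bar> < 1 / Suc n)"

lemma approximate_delta_antimono:
  assumes "approximate_delta N r f" "n \<le> N"
  shows "approximate_delta n r f"
proof -
  have "1 / real (Suc N) \<le> 1 / real (Suc n)"
    using assms(2) by (intro divide_left_mono) auto
  then show ?thesis
    using assms unfolding approximate_delta_def by (meson le_trans less_le_trans)
qed

lemma mollifier_test_function: "mollifier r f \<Longrightarrow> f \<in> test_functions"
  unfolding test_function_iff mollifier_def
  by (auto intro!: bounded_subset[OF bounded_ball[of 0 r]] simp: not_le[symmetric])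

lemma finite_mdeg_le: "finite {\<alpha> :: 'n::finite \<Rightarrow> nat. mdeg \<alpha> \<le> n}"
proof (rule finite_subset)
  show "finite (UNIV \<rightarrow>\<^sub>E {..n} :: ('n \<Rightarrow> nat) set)"
    by (intro finite_PiE) auto
  have "\<alpha> i \<le> mdeg \<alpha>" for \<alpha> and i :: 'n
    unfolding mdeg_def by (rule member_le_sum) auto
  then show "{\<alpha> :: 'n \<Rightarrow> nat. mdeg \<alpha> \<le> n} \<subseteq> UNIV \<rightarrow>\<^sub>E {..n}"
    by (auto simp: PiE_def intro: le_trans)
qed

text \<open>The powers of \<open>r\<close> from the normalisation and from the chain rule cancel the weight exactly, so the
  bound does not depend on \<open>r\<close>.\<close>

lemma SUP_mpartial_rescale_le:
  fixes f :: "real ^ 'n::finite \<Rightarrow> complex"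
  assumes f: "smooth f" and B: "\<And>x. cmod (mpartial \<alpha> f x) \<le> B" and r: "r > 0"
  shows "\<bar>r ^ (CARD('n) + mdeg \<alpha>) * (SUP x. cmod (mpartial \<alpha> (rescale r f) x))\<bar> \<le> B"
proof -
  let ?c = "r ^ (CARD('n) + mdeg \<alpha>)"
  have eq: "cmod (mpartial \<alpha> (rescale r f) x) = cmod (mpartial \<alpha> f ((1 / r) *\<^sub>R x)) / ?c" for x
    unfolding rescale_def[abs_def] mpartial_scale[OF f]
    using r by (simp add: norm_mult norm_divide norm_power power_add power_divide)
  have le: "cmod (mpartial \<alpha> (rescale r f) x) \<le> B / ?c" for x
    unfolding eq using B r by (intro divide_right_mono) auto
  have "0 \<le> (SUP x. cmod (mpartial \<alpha> (rescale r f) x))"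
    by (rule cSUP_upper2[of _ _ undefined]) (auto intro: le bdd_aboveI)
  moreover have "(SUP x. cmod (mpartial \<alpha> (rescale r f) x)) \<le> B / ?c"
    by (rule cSUP_least) (auto intro: le)
  ultimately show ?thesis
    using r by (simp add: field_simps)
qed

text \<open>One mollifier \<open>f\<close> with enough vanishing moments serves for all small radii: its rescalings keep
  every condition, and there are only finitely many multiindices up to order \<open>n\<close>, so a common bound \<open>M\<close>
  on the weighted suprema is beaten by \<open>\<bar>ln r\<bar>\<close>.\<close>

lemma ex_approximate_delta:
  "\<exists>\<delta>>0. \<forall>r. 0 < r \<longrightarrow> r < \<delta> \<longrightarrow> (\<exists>f :: real ^ 'n::finite \<Rightarrow> complex. approximate_delta n r f)"
proof -
  obtain f :: "real ^ 'n \<Rightarrow> complex" where f: "mollifier 1 f" "L1_norm f < 1 + 1 / Suc n"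
    "\<And>\<alpha>. \<alpha> \<noteq> (\<lambda>_. 0) \<Longrightarrow> mdeg \<alpha> \<le> n \<Longrightarrow> moment f \<alpha> = 0"
    using ex_vanishing_moments[of "1 / Suc n" n] by auto
  have sm: "smooth f" using f(1) by (simp add: mollifier_def)
  have "\<exists>B. \<forall>x. cmod (mpartial \<alpha> f x) \<le> B" for \<alpha>
    using mpartial_bounded[OF sm, of "cball 0 1" \<alpha>] f(1)
    by (auto simp: mollifier_def bounded_iff)
  then obtain B where B: "\<And>\<alpha> x. cmod (mpartial \<alpha> f x) \<le> B \<alpha>"
    by metis
  define M where "M = Max (insert 1 (B ` {\<alpha>. mdeg \<alpha> \<le> n}))"
  have M: "M \<ge> 1" "\<And>\<alpha>. mdeg \<alpha> \<le> n \<Longrightarrow> B \<alpha> \<le> M"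
    using finite_mdeg_le[of n] unfolding M_def by (auto intro!: Max_ge)
  show ?thesis
  proof (intro exI[of _ "exp (- (Suc n * M))"] conjI allI impI)
    fix r :: real assume r: "0 < r" "r < exp (- (Suc n * M))"
    have "ln r < - (Suc n * M)"
      using r by (metis ln_exp ln_less_cancel_iff exp_gt_zero)
    moreover have "Suc n * M > 0"
      using M(1) by (intro mult_pos_pos) auto
    ultimately have ln: "\<bar>ln r\<bar> > Suc n * M" "\<bar>ln r\<bar> > 0"
      by linarith+
    note g = rescale_mollifier[OF f(1) r(1)]
    have "\<bar>inverse \<bar>ln r\<bar> * (r ^ (CARD('n) + mdeg \<alpha>) * (SUP x. cmod (mpartial \<alpha> (rescale r f) x)))\<bar>
        < 1 / Suc n" if "mdeg \<alpha> \<le> n" for \<alpha>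
    proof -
      have "\<bar>r ^ (CARD('n) + mdeg \<alpha>) * (SUP x. cmod (mpartial \<alpha> (rescale r f) x))\<bar> \<le> M"
        using SUP_mpartial_rescale_le[OF sm B r(1)] M(2)[OF that] by (rule order_trans)
      then have "\<bar>inverse \<bar>ln r\<bar> * (r ^ (CARD('n) + mdeg \<alpha>) *
          (SUP x. cmod (mpartial \<alpha> (rescale r f) x)))\<bar> \<le> inverse \<bar>ln r\<bar> * M"
        unfolding abs_mult[of "inverse \<bar>ln r\<bar>"] using ln(2) by (simp add: field_simps)
      also have "\<dots> < 1 / Suc n"
        using ln by (simp add: field_simps)
      finally show ?thesis .
    qed
    moreover have "L1_norm f \<ge> 1"
    proof -
      have "1 = cmod (LINT x|lebesgue. f x)"
        using f(1) by (simp add: mollifier_def)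
      also have "\<dots> \<le> L1_norm f"
        by (rule integral_norm_bound)
      finally show ?thesis .
    qed
    ultimately have "approximate_delta n r (rescale r f)"
      using f(2,3) g by (simp add: approximate_delta_def)
    then show "\<exists>f :: real ^ 'n \<Rightarrow> complex. approximate_delta n r f"
      by blast
  qed simp
qed

section \<open>Delta functions at an infinitesimal radius\<close>

definition approximate_deltas :: "nat \<Rightarrow> 'n::finite obj list set" where
  "approximate_deltas n = {[Fn f, Rl r] |f r. approximate_delta n r f}"

lemma happ_iff:
  assumes "nonstandard_extension star ext"
  shows "happ ext f x = y \<longleftrightarrow> [f, x, y] \<in> ext {[a, b, Num (fn a (pt b))] |a b. True}"
  using nonstandard_extension.hfun2_iff[OF assms] by (simp add: happ_def)

text \<open>Each condition on a delta function is either contained in the conditions at level \<open>n\<close>, for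
  \<open>n\<close> at least the order of the multiindex in question, or an infinitesimality statement, for which
  \<open>n\<close> is taken large compared with \<open>1 / \<epsilon>\<close>; in both cases the implication is transferred.\<close>

lemma delta_functionI:
  fixes star :: "'n::finite obj \<Rightarrow> 'h"
  assumes ns: "nonstandard_extension star ext"
    and D: "\<And>n. [D, \<rho>] \<in> ext (approximate_deltas n)"
  shows "delta_function star ext \<rho> D"
proof -
  interpret nonstandard_extension star ext by (fact ns)
  let ?graph = "{[a, b, Num (fn a (pt b))] |a b. True} :: 'n obj list set"
  note happ = happ_iff[OF ns]
  let ?R = approximate_deltas
  note app = happ[THEN iffD1, OF refl]
  note std = approximate_deltas_def approximate_delta_def mollifier_def
  have "map ((!) [D, \<rho>]) [0] \<in> ext {[a] |a. a \<in> Fn ` test_functions}"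
    by (rule transfer_horn[where ps = "[(?R 0, [0, 1])]"],
        force simp: approximate_deltas_def approximate_delta_def intro: mollifier_test_function,
        simp add: D)
  then have "D \<in> htest_functions ext"
    by (simp add: htest_functions_def hset_def)
  moreover have "happ ext D x \<in> hreals ext" for x
  proof -
    have "map ((!) [D, \<rho>, x, happ ext D x]) [3] \<in> ext {[a] |a. a \<in> {Num z |z. z \<in> \<real>}}"
      by (rule transfer_horn[where ps = "[(?R 0, [0, 1]), (?graph, [0, 2, 3])]"],
          force simp: std, use D app[of D x] in simp)
    then show ?thesis
      by (simp add: hreals_def hset_def)
  qed
  moreover have "happ ext D (hminus ext x) = happ ext D x" for x
  proof -
    let ?minus = "{[a, Pt (- pt a)] |a. True} :: 'n obj list set"
    have "[x, hminus ext x] \<in> ext ?minus"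
      unfolding hminus_def
      by (rule hfun_iff[where F = "\<lambda>x. Pt (- pt x)", THEN iffD1, OF refl])
    then have "map ((!) [D, \<rho>, x, happ ext D x, hminus ext x]) [0, 4, 3] \<in> ext ?graph"
      by (intro transfer_horn[where ps = "[(?R 0, [0, 1]), (?minus, [2, 4]), (?graph, [0, 2, 3])]"],
          force simp: std, use D app[of D x] in simp)
    then show ?thesis
      by (simp add: happ)
  qed
  moreover have "happ ext D x = star (Num 0)"
    if "hrel ext (\<lambda>x r. norm (pt x) \<ge> rl r) x \<rho>" for x
  proof -
    have "map ((!) [D, \<rho>, x, happ ext D x]) [3] \<in> ext {[Num 0]}"
      by (rule transfer_horn[where ps = "[(?R 0, [0, 1]), ({[a, b] |a b. norm (pt a) \<ge> rl b}, [2, 1]),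
            (?graph, [0, 2, 3])]"],
          force simp: std, use that D app[of D x] in \<open>simp add: hrel_def\<close>)
    then show ?thesis
      by (simp add: ext_singleton)
  qed
  moreover have hfun_value: "hfun ext F D = star c"
    if "\<And>f r. approximate_delta n r f \<Longrightarrow> F (Fn f) = c" for F n c
  proof -
    let ?F = "{[a, F a] |a. True}"
    have "[D, hfun ext F D] \<in> ext ?F"
      using hfun_iff by blast
    then have "map ((!) [D, \<rho>, hfun ext F D]) [2] \<in> ext {[c]}"
      by (intro transfer_horn[where ps = "[(?R n, [0, 1]), (?F, [0, 2])]"],
          use that in \<open>force simp: approximate_deltas_def\<close>, simp add: D)
    then show ?thesis
      by (simp add: ext_singleton)
  qed
  have "hfun ext (\<lambda>f. Num (LINT x|lebesgue. fn f x)) D = star (Num 1)"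
    by (rule hfun_value[of 0]) (simp add: approximate_delta_def mollifier_def)
  moreover have "hfun ext (\<lambda>f. Num (LINT x|lebesgue. fn f x * complex_of_real (mono_pow x \<alpha>))) D
      = star (Num 0)" if "\<alpha> \<noteq> (\<lambda>_. 0)" for \<alpha> :: "'n \<Rightarrow> nat"
    by (rule hfun_value[of "mdeg \<alpha>"]) (use that in \<open>simp add: approximate_delta_def\<close>)
  moreover have hfun2_close: "infinitely_close ext (hfun2 ext F \<rho> D) (star (Num c))"
    if close: "\<And>\<epsilon>. \<epsilon> > 0 \<Longrightarrow> \<exists>n. \<forall>r f. approximate_delta n r f \<longrightarrow>
      (\<exists>z. F (Rl r) (Fn f) = Num z \<and> cmod (z - c) < \<epsilon>)" for F c
    unfolding infinitely_close_def
  proof (intro allI impI)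
    fix \<epsilon> :: real assume "\<epsilon> > 0"
    then obtain n where n: "\<And>r f. approximate_delta n r f \<Longrightarrow>
        \<exists>z. F (Rl r) (Fn f) = Num z \<and> cmod (z - c) < \<epsilon>"
      using close[OF \<open>\<epsilon> > 0\<close>] by blast
    let ?F = "{[a, b, F a b] |a b. True}"
    let ?close = "{[a, b] |a b. \<exists>z w. a = Num z \<and> b = Num w \<and> cmod (z - w) < \<epsilon>}"
    have "[\<rho>, D, hfun2 ext F \<rho> D] \<in> ext ?F"
      using hfun2_iff by blast
    then have "map ((!) [D, \<rho>, hfun2 ext F \<rho> D, star (Num c)]) [2, 3] \<in> ext ?close"
      by (intro transfer_horn[where ps = "[(?R n, [0, 1]), (?F, [1, 0, 2]), ({[Num c]}, [3])]"],
          use n in \<open>fastforce simp: approximate_deltas_def\<close>, simp add: D ext_singleton)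
    then show "hrel ext (\<lambda>a b. \<exists>z w. a = Num z \<and> b = Num w \<and> cmod (z - w) < \<epsilon>)
        (hfun2 ext F \<rho> D) (star (Num c))"
      by (simp add: hrel_def)
  qed
  have "infinitely_close ext (hfun ext (\<lambda>f. Rl (LINT x|lebesgue. cmod (fn f x))) D) (star (Num 1))"
    unfolding hfun2_const[where k = \<rho>, symmetric]
  proof (rule hfun2_close)
    fix \<epsilon> :: real assume "\<epsilon> > 0"
    then obtain n where n: "1 / real (Suc n) < \<epsilon>"
      by (metis nat_approx_posE)
    have "cmod (of_real (L1_norm f) - 1) < \<epsilon>"
      if "approximate_delta n r f" for r and f :: "real ^ 'n \<Rightarrow> complex"
    proof -
      have "\<bar>L1_norm f - 1\<bar> < \<epsilon>"
        using that n unfolding approximate_delta_def by linarith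
      then show ?thesis
        by (metis norm_of_real of_real_1 of_real_diff)
    qed
    then show "\<exists>n. \<forall>r f. approximate_delta n r f \<longrightarrow>
        (\<exists>z. Rl (LINT x|lebesgue. cmod (fn (Fn f :: 'n obj) x)) = (Num z :: 'n obj) \<and> cmod (z - 1) < \<epsilon>)"
      by auto
  qed
  moreover have "infinitely_close ext
      (hfun2 ext (\<lambda>r f. Rl (inverse \<bar>ln (rl r)\<bar> *
        (rl r ^ (CARD('n) + mdeg \<alpha>) * (SUP x. cmod (mpartial \<alpha> (fn f) x))))) \<rho> D)
      (star (Num 0))" for \<alpha> :: "'n \<Rightarrow> nat"
  proof (rule hfun2_close)
    let ?v = "\<lambda>r f. inverse \<bar>ln r\<bar> * (r ^ (CARD('n) + mdeg \<alpha>) * (SUP x. cmod (mpartial \<alpha> f x)))"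
    fix \<epsilon> :: real assume "\<epsilon> > 0"
    then obtain n where n: "1 / real (Suc n) < \<epsilon>"
      by (metis nat_approx_posE)
    have "\<bar>?v r f\<bar> < \<epsilon>" if "approximate_delta (max n (mdeg \<alpha>)) r f" for r f
    proof -
      have "\<bar>?v r f\<bar> < 1 / real (Suc (max n (mdeg \<alpha>)))"
        using that unfolding approximate_delta_def by (meson max.cobounded2)
      also have "\<dots> \<le> 1 / real (Suc n)"
        by (intro divide_left_mono) auto
      finally show ?thesis
        using n by linarith
    qed
    then have "cmod (complex_of_real (?v r f) - 0) < \<epsilon>"
      if "approximate_delta (max n (mdeg \<alpha>)) r f" for r f
      unfolding diff_zero norm_of_real using that by blast
    then show "\<exists>n. \<forall>r f. approximate_delta n r f \<longrightarrow>
        (\<exists>z. (Rl (inverse \<bar>ln (rl (Rl r :: 'n obj))\<bar> *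
          (rl (Rl r :: 'n obj) ^ (CARD('n) + mdeg \<alpha>) *
           (SUP x. cmod (mpartial \<alpha> (fn (Fn f :: 'n obj)) x)))) :: 'n obj) = Num z \<and> cmod (z - 0) < \<epsilon>)"
      unfolding obj.sel Re_complex_of_real by blast
  qed
  ultimately show ?thesis
    unfolding delta_function_def by blast
qed

theorem theorem3p3:
  fixes star :: "'n::finite obj \<Rightarrow> 'h"
    and ext :: "'n obj list set \<Rightarrow> 'h list set"
    and \<rho> :: 'h
  assumes "nonstandard_model star ext"
    and "\<rho> \<in> hreals ext"
    and "hless ext (star (Num 0)) \<rho>"
    and "infinitely_close ext \<rho> (star (Num 0))"
  shows "\<exists>D. delta_function star ext \<rho> D"
proof -
  have ns: "nonstandard_extension star ext" and sat: "countably_saturated ext"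
    using assms(1) by (auto simp: nonstandard_model_def nonstandard_extension_def)
  interpret nonstandard_extension star ext by (fact ns)
  \<comment> \<open>Writing the set as a section of an extended relation at \<open>\<rho>\<close> exhibits it as internal.\<close>
  define A where "A n = {h. h # [\<rho>] \<in> ext (approximate_deltas n)}" for n
  have nonempty: "A n \<noteq> {}" for n
  proof -
    obtain \<delta> where "\<delta> > 0"
      and \<delta>: "\<And>r. 0 < r \<Longrightarrow> r < \<delta> \<Longrightarrow> \<exists>f :: real ^ 'n \<Rightarrow> complex. approximate_delta n r f"
      using ex_approximate_delta by metis
    \<comment> \<open>Every standard \<open>r\<close> in \<open>(0, \<delta>)\<close> is the radius of an approximate delta function, and \<open>\<rho>\<close> lies in the extension of this interval.\<close>
    have "[\<rho>] \<in> ext {[b] |b. \<exists>a. [a, b] \<in> approximate_deltas n}"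
      using transfer_horn[of "[({[a, b] |a b. \<exists>r s. a = Rl r \<and> b = Rl s \<and> r < s}, [0, 1]),
            ({[a, b] |a b. \<exists>z w. a = Num z \<and> b = Num w \<and> cmod (z - w) < \<delta>}, [1, 0]),
            ({[Num 0]}, [0])]" "[1]"
          "{[b] |b. \<exists>a. [a, b] \<in> approximate_deltas n}" "(!) [star (Num 0), \<rho>]"] \<delta>
        assms(3,4) \<open>\<delta> > 0\<close>
      by (force simp: hless_def infinitely_close_def hrel_def ext_singleton approximate_deltas_def)
    then show ?thesis
      using ext_projection by (fastforce simp: A_def)
  qed
  have antimono: "A N \<subseteq> A n" if "n \<le> N" for n N
  proof
    fix D assume "D \<in> A N"
    then show "D \<in> A n"
      using transfer_horn[of "[(approximate_deltas N, [0, 1])]" "[0, 1]" "approximate_deltas n"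
          "(!) [D, \<rho>]"] approximate_delta_antimono[OF _ that]
      by (fastforce simp: A_def approximate_deltas_def)
  qed
  have "\<Inter>\<F> \<noteq> {}" if \<F>: "finite \<F>" "\<F> \<subseteq> range A" for \<F>
  proof -
    obtain I where "finite I" "\<F> = A ` I"
      using finite_subset_image[OF \<F>] by blast
    moreover obtain N where "\<forall>i\<in>I. i \<le> N"
      using \<open>finite I\<close> finite_nat_set_iff_bounded_le by blast
    ultimately have "A N \<subseteq> \<Inter>\<F>"
      using antimono by blast
    then show ?thesis
      using nonempty[of N] by blast
  qed
  moreover have "internal ext (A n)" for n
    unfolding internal_def A_def by blast
  ultimately have "\<Inter>(range A) \<noteq> {}"
    using sat unfolding countably_saturated_def by (metis countableI_type countable_image rangeE)
  then obtain D where "\<And>n. D \<in> A n" by blast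
  then show ?thesis
    using delta_functionI[OF ns] by (auto simp: A_def)
qed

end
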